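(* Let $m$ be a Borel probability measure on $\mathbb{R}$ with cumulative distribution function $F$, and for $n\ge1$ let $\mu^n:=\frac1n\sum_{k=1}^n\delta_{x_k}$ with $x_k:=F^{-1}\left(\frac{2k-1}{2n}\right)$, $k\in\{1,\ldots,n\}$. Then: (i) $\lim_{n\to+\infty}W_1(m,\mu^n)=0$ if and only if $m$ has a finite first order moment. (ii) For all $n\ge1$, $$W_1(m,\mu^n)\le\frac{1}{\sqrt n}\int_{\mathbb{R}}\sqrt{F(x)(1-F(x))}\,dx,$$ where the right-hand side may be infinite. (iii) If there exist $-\infty<a<b<+\infty$ such that $m([a,b])=1$, then for all $n\ge1$, $$W_1(m,\mu^n)\le\frac{b-a}{2n}.$$ (iv) If $m(dx)=\mathbf{1}_{\{x\in[a,b]\}}f(x)\,dx$ with $f$ positive on $[a,b]$, where $-\infty<a<b<+\infty$, then $$\lim_{n\to+\infty}nW_1(m,\mu^n)=\frac{b-a}{4}.$$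
   Context: $F(x)=m((-\infty,x])$, and $F^{-1}(v):=\inf\{x\in\mathbb{R}:F(x)\ge v\}$ for $v\in(0,1)$. $W_1$ is the Wasserstein distance of order 1 on probability measures on $\mathbb{R}$, $W_1(m,m'):=\inf\int_{\mathbb{R}^2}|x-x'|\,\mathfrak{m}(dx\,dx')$ over all couplings $\mathfrak{m}$ of $m$ and $m'$; it may take the value $+\infty$. *)

theory Defs
  imports "HOL-Probability.Probability"
begin

definition couplings :: "real measure \<Rightarrow> real measure \<Rightarrow> (real \<times> real) measure set" where
  "couplings m m' = {\<pi>. prob_space \<pi> \<and> sets \<pi> = sets borel \<and>
     distr \<pi> borel fst = m \<and> distr \<pi> borel snd = m'}"

definition W1 :: "real measure \<Rightarrow> real measure \<Rightarrow> ennreal" where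
  "W1 m m' = (INF \<pi>\<in>couplings m m'. \<integral>\<^sup>+ p. ennreal \<bar>fst p - snd p\<bar> \<partial>\<pi>)"

(* Meaningful for v in (0,1): only then is the set nonempty and bounded below for every
   probability measure m. *)
definition quantile :: "real measure \<Rightarrow> real \<Rightarrow> real" where
  "quantile m v = Inf {x. cdf m x \<ge> v}"

definition quantile_node :: "real measure \<Rightarrow> nat \<Rightarrow> nat \<Rightarrow> real" where
  "quantile_node m n k = quantile m (real (2 * k - 1) / real (2 * n))"

(* The library has no addition of measures, so the sum of Dirac masses is given setwise;
   the lemmas below confirm that for n \<ge> 1 it is a measure with these values. *)
definition quantile_empirical :: "real measure \<Rightarrow> nat \<Rightarrow> real measure" where
  "quantile_empirical m n = measure_of UNIV (sets borel)
     (\<lambda>A. ennreal (1 / real n) * (\<Sum>k=1..n. emeasure (return borel (quantile_node m n k)) A))"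

lemma sets_quantile_empirical [simp]: "sets (quantile_empirical m n) = sets borel"
  unfolding quantile_empirical_def
  by (simp add: sets_measure_of_conv, metis sets.sigma_sets_eq space_borel)

lemma space_quantile_empirical [simp]: "space (quantile_empirical m n) = UNIV"
  by (simp add: quantile_empirical_def space_measure_of_conv)

lemma emeasure_quantile_empirical:
  assumes "A \<in> sets borel"
  shows "emeasure (quantile_empirical m n) A =
    ennreal (1 / real n) * (\<Sum>k=1..n. emeasure (return borel (quantile_node m n k)) A)"
proof (rule emeasure_measure_of[OF quantile_empirical_def])
  let ?S = "\<lambda>A. ennreal (1 / real n) * (\<Sum>k=1..n. emeasure (return borel (quantile_node m n k)) A)"
  show "sets borel \<subseteq> Pow (UNIV :: real set)" by simp
  show "A \<in> sets (quantile_empirical m n)" using assms by simp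
  show "positive (sets (quantile_empirical m n)) ?S" by (simp add: positive_def)
  show "countably_additive (sets (quantile_empirical m n)) ?S"
  proof (rule countably_additiveI)
    fix B :: "nat \<Rightarrow> real set"
    assume B: "range B \<subseteq> sets (quantile_empirical m n)" "disjoint_family B"
      "(\<Union>i. B i) \<in> sets (quantile_empirical m n)"
    have "(\<Sum>i. ?S (B i)) = ennreal (1 / real n) *
        (\<Sum>i. \<Sum>k=1..n. emeasure (return borel (quantile_node m n k)) (B i))"
      by (rule ennreal_suminf_cmult)
    also have "(\<Sum>i. \<Sum>k=1..n. emeasure (return borel (quantile_node m n k)) (B i)) =
        (\<Sum>k=1..n. \<Sum>i. emeasure (return borel (quantile_node m n k)) (B i))"
      by (rule suminf_sum) (auto intro: summableI)
    also have "\<dots> = (\<Sum>k=1..n. emeasure (return borel (quantile_node m n k)) (\<Union>i. B i))"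
      using B by (intro sum.cong refl suminf_emeasure) auto
    finally show "(\<Sum>i. ?S (B i)) = ?S (\<Union>i. B i)" .
  qed
qed

lemma real_distribution_quantile_empirical:
  assumes "n \<ge> 1"
  shows "real_distribution (quantile_empirical m n)"
proof -
  have "emeasure (quantile_empirical m n) UNIV = ennreal (1 / real n) * ennreal (real n)"
    by (simp add: emeasure_quantile_empirical ennreal_of_nat_eq_real_of_nat)
  also have "\<dots> = 1"
    using assms by (simp add: ennreal_mult[symmetric])
  finally have "prob_space (quantile_empirical m n)"
    by (intro prob_spaceI) simp
  then show ?thesis
    by (simp add: real_distribution_def real_distribution_axioms_def)
qed

end

theory Submission
  imports Defs
begin

text \<open>
On the line the quantile coupling is optimal and \<open>W1 m m'\<close> is the area between the two
distribution functions (\<open>W1_eq_nn_integral_cdf\<close>). The quantile nodes are chosen such that the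
distribution function of the empirical measure at \<open>t\<close> is \<open>F t\<close> rounded to the nearest multiple
of \<open>1 / n\<close> (\<open>cdf_quantile_empirical\<close>): by the Galois connection between quantiles and \<open>F\<close>, the
\<open>k\<close>-th node is at most \<open>t\<close> iff \<open>k \<le> n F t + 1 / 2\<close>. Together these give the exact formula
\<open>n W1 = \<integral> d (n F t) dt\<close>, where \<open>d\<close> is the distance to the nearest integer
(\<open>W1_quantile_empirical\<close>), and all four claims become statements about this integral.

The two nonasymptotic bounds come from \<open>d (n p)\<^sup>2 \<le> n p (1 - p)\<close> and from \<open>d \<le> 1 / 2\<close>. For the
convergence criterion, the first absolute moment is the integral of \<open>F\<close> over the negative and of
\<open>1 - F\<close> over the positive half line; this integrand dominates \<open>d (n F) / n\<close>, and for fixed \<open>n\<close> the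
two agree near \<open>\<plusminus>\<infinity>\<close>.

The sharp constant \<open>(b - a) / 4\<close> reflects the mean \<open>1 / 4\<close> of the periodic function \<open>d\<close>. Writing
\<open>dt = h dm\<close> with \<open>h = 1 / f\<close>, which is \<open>m\<close>-integrable, one needs
\<open>\<integral> h (t) d (n F t) dm \<longrightarrow> 1/4 \<integral> h dm\<close> (\<open>tendsto_integral_nearest_int_dist_cdf\<close>). As \<open>m\<close> has no atoms,
\<open>F\<close> is uniformly distributed under \<open>m\<close>; hence for the indicator of a half line the claim is
about \<open>\<integral>\<^sub>0\<^sup>c d (n u) du\<close>, and it extends from half lines to all integrable functions because the
kernels are uniformly bounded (\<open>tendsto_integral_mult_pi_system\<close>).
\<close>

section \<open>The Wasserstein distance on the line as an area\<close>

text \<open>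
The distance of two reals is the length of the set of levels that separate them, and Tonelli
exchanges the integral over the levels with that over the sample space.
\<close>

lemma nn_integral_abs_diff_layers:
  fixes X Y :: "'a \<Rightarrow> real"
  assumes "sigma_finite_measure M"
    and [measurable]: "X \<in> borel_measurable M" "Y \<in> borel_measurable M"
  shows "(\<integral>\<^sup>+ x. ennreal \<bar>X x - Y x\<bar> \<partial>M) =
    (\<integral>\<^sup>+ t. emeasure M {x \<in> space M. X x \<le> t \<and> t < Y x} +
             emeasure M {x \<in> space M. Y x \<le> t \<and> t < X x} \<partial>lborel)"
proof -
  interpret M: sigma_finite_measure M by fact
  interpret pair_sigma_finite M lborel ..
  let ?g = "\<lambda>x t. indicator {X x..<Y x} t + indicator {Y x..<X x} t :: ennreal"
  have meas: "(\<lambda>(x, t). ?g x t) \<in> borel_measurable (M \<Otimes>\<^sub>M lborel)"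
    unfolding indicator_def atLeastLessThan_iff by measurable
  have "(\<integral>\<^sup>+ x. ennreal \<bar>X x - Y x\<bar> \<partial>M) = (\<integral>\<^sup>+ x. \<integral>\<^sup>+ t. ?g x t \<partial>lborel \<partial>M)"
  proof (intro nn_integral_cong)
    fix x
    show "ennreal \<bar>X x - Y x\<bar> = (\<integral>\<^sup>+ t. ?g x t \<partial>lborel)"
      by (cases "X x \<le> Y x") (auto simp: nn_integral_add)
  qed
  also have "\<dots> = (\<integral>\<^sup>+ t. \<integral>\<^sup>+ x. ?g x t \<partial>M \<partial>lborel)"
    using Fubini'[OF meas] by simp
  also have "\<dots> = (\<integral>\<^sup>+ t. emeasure M {x \<in> space M. X x \<le> t \<and> t < Y x} +
             emeasure M {x \<in> space M. Y x \<le> t \<and> t < X x} \<partial>lborel)"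
  proof (intro nn_integral_cong)
    fix t
    have "(\<integral>\<^sup>+ x. ?g x t \<partial>M) =
      (\<integral>\<^sup>+ x. indicator {x \<in> space M. X x \<le> t \<and> t < Y x} x +
             indicator {x \<in> space M. Y x \<le> t \<and> t < X x} x \<partial>M)"
      by (intro nn_integral_cong) (auto simp: indicator_def)
    also have "\<dots> = emeasure M {x \<in> space M. X x \<le> t \<and> t < Y x} +
             emeasure M {x \<in> space M. Y x \<le> t \<and> t < X x}"
      by (subst nn_integral_add) auto
    finally show "(\<integral>\<^sup>+ x. ?g x t \<partial>M) = \<dots>" .
  qed
  finally show ?thesis .
qed

text \<open>
For every coupling the cost is the integral over all levels \<open>t\<close> of the mass that is carried across
\<open>t\<close>. This mass is at least the net flow \<open>\<bar>F t - G t\<bar>\<close>, and the quantile coupling moves mass across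
each level in one direction only.
\<close>

lemma W1_eq_nn_integral_cdf:
  assumes "real_distribution m" "real_distribution m'"
  shows "W1 m m' = (\<integral>\<^sup>+ t. ennreal \<bar>cdf m t - cdf m' t\<bar> \<partial>lborel)"
proof (rule antisym)
  interpret m: cdf_distribution m using assms(1) by (simp add: cdf_distribution_def)
  interpret m': cdf_distribution m' using assms(2) by (simp add: cdf_distribution_def)
  show "(\<integral>\<^sup>+ t. ennreal \<bar>cdf m t - cdf m' t\<bar> \<partial>lborel) \<le> W1 m m'"
    unfolding W1_def
  proof (rule INF_greatest)
    fix \<pi> assume "\<pi> \<in> couplings m m'"
    then have \<pi>: "prob_space \<pi>" and sets_\<pi>[measurable_cong]: "sets \<pi> = sets borel"
      and fst: "distr \<pi> borel fst = m" and snd: "distr \<pi> borel snd = m'"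
      by (auto simp: couplings_def)
    interpret \<pi>: prob_space \<pi> by fact
    have space: "space \<pi> = UNIV"
      using sets_eq_imp_space_eq[OF sets_\<pi>] by simp
    have [measurable]: "fst \<in> borel_measurable \<pi>" "snd \<in> borel_measurable \<pi>"
      by (simp_all add: measurable_cong_sets[OF sets_\<pi> refl] borel_measurable_continuous_onI
          continuous_on_fst continuous_on_snd)
    have F: "cdf m t = \<pi>.prob {p. fst p \<le> t}" "cdf m' t = \<pi>.prob {p. snd p \<le> t}" for t
      by (simp_all add: cdf_def fst[symmetric] snd[symmetric] measure_distr space vimage_def)
    have meas[measurable]: "{p. fst p \<le> t} \<in> sets \<pi>" "{p. snd p \<le> t} \<in> sets \<pi>"
      "{p. fst p \<le> t \<and> t < snd p} \<in> sets \<pi>" "{p. snd p \<le> t \<and> t < fst p} \<in> sets \<pi>" for t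
      using measurable_sets[of fst \<pi> borel "{..t}"] measurable_sets[of snd \<pi> borel "{..t}"]
        measurable_sets[of fst \<pi> borel "{t<..}"] measurable_sets[of snd \<pi> borel "{t<..}"]
      by (auto simp: vimage_def space Collect_conj_eq intro!: sets.Int)
    have "(\<integral>\<^sup>+ t. ennreal \<bar>cdf m t - cdf m' t\<bar> \<partial>lborel) \<le>
      (\<integral>\<^sup>+ t. emeasure \<pi> {p \<in> space \<pi>. fst p \<le> t \<and> t < snd p} +
             emeasure \<pi> {p \<in> space \<pi>. snd p \<le> t \<and> t < fst p} \<partial>lborel)"
    proof (intro nn_integral_mono)
      fix t
      \<comment> \<open>Mass moves across level t in both directions, and the net flow is F(t) - G(t).\<close>
      have "\<pi>.prob {p. fst p \<le> t} \<le> \<pi>.prob ({p. snd p \<le> t} \<union> {p. fst p \<le> t \<and> t < snd p})"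
        "\<pi>.prob {p. snd p \<le> t} \<le> \<pi>.prob ({p. fst p \<le> t} \<union> {p. snd p \<le> t \<and> t < fst p})"
        by (rule \<pi>.finite_measure_mono; auto)+
      then have "\<bar>cdf m t - cdf m' t\<bar> \<le>
          \<pi>.prob {p. fst p \<le> t \<and> t < snd p} + \<pi>.prob {p. snd p \<le> t \<and> t < fst p}"
        unfolding F
        using measure_Un_le[OF meas(2) meas(3), of t t]
          measure_Un_le[OF meas(1) meas(4), of t t]
          measure_nonneg[of \<pi> "{p. fst p \<le> t \<and> t < snd p}"]
          measure_nonneg[of \<pi> "{p. snd p \<le> t \<and> t < fst p}"]
        by linarith
      then show "ennreal \<bar>cdf m t - cdf m' t\<bar> \<le>
        emeasure \<pi> {p \<in> space \<pi>. fst p \<le> t \<and> t < snd p} +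
             emeasure \<pi> {p \<in> space \<pi>. snd p \<le> t \<and> t < fst p}"
        by (simp add: space \<pi>.emeasure_eq_measure ennreal_plus[symmetric] ennreal_leI del: ennreal_plus)
    qed
    also have "\<dots> = (\<integral>\<^sup>+ p. ennreal \<bar>fst p - snd p\<bar> \<partial>\<pi>)"
      by (rule nn_integral_abs_diff_layers[symmetric]) (auto intro: \<pi>.sigma_finite_measure_axioms)
    finally show "(\<integral>\<^sup>+ t. ennreal \<bar>cdf m t - cdf m' t\<bar> \<partial>lborel) \<le>
      (\<integral>\<^sup>+ p. ennreal \<bar>fst p - snd p\<bar> \<partial>\<pi>)" .
  qed
  show "W1 m m' \<le> (\<integral>\<^sup>+ t. ennreal \<bar>cdf m t - cdf m' t\<bar> \<partial>lborel)"
  proof -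
    \<comment> \<open>The optimal coupling is the law of both quantile functions under one uniform variable.\<close>
    define \<Omega> where "\<Omega> = restrict_space lborel {0<..<1::real}"
    interpret \<Omega>: prob_space \<Omega>
      by (auto simp: \<Omega>_def emeasure_restrict_space space_restrict_space intro!: prob_spaceI)
    have sets_\<Omega>: "sets \<Omega> = sets (restrict_space borel {0<..<1})"
      by (simp add: \<Omega>_def sets_restrict_space)
    have [measurable]: "m.I \<in> borel_measurable \<Omega>" "m'.I \<in> borel_measurable \<Omega>"
      using m.measurable_CI m'.measurable_CI by (simp_all add: measurable_cong_sets[OF sets_\<Omega> refl])
    define \<pi> where "\<pi> = distr \<Omega> borel (\<lambda>u. (m.I u, m'.I u))"
    have pair[measurable]: "(\<lambda>u. (m.I u, m'.I u)) \<in> \<Omega> \<rightarrow>\<^sub>M borel"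
      by (simp add: borel_prod[symmetric])
    have [measurable]: "(fst :: real \<times> real \<Rightarrow> real) \<in> borel_measurable borel"
      "(snd :: real \<times> real \<Rightarrow> real) \<in> borel_measurable borel"
      by (simp_all add: borel_measurable_continuous_onI continuous_on_fst continuous_on_snd)
    have "distr \<pi> borel fst = m" "distr \<pi> borel snd = m'"
      using m.distr_I_eq_M m'.distr_I_eq_M
      by (simp_all add: \<pi>_def distr_distr comp_def \<Omega>_def[symmetric])
    then have "\<pi> \<in> couplings m m'"
      by (simp add: couplings_def \<pi>_def \<Omega>.prob_space_distr)
    then have "W1 m m' \<le> (\<integral>\<^sup>+ p. ennreal \<bar>fst p - snd p\<bar> \<partial>\<pi>)"
      unfolding W1_def by (rule INF_lower)
    also have "\<dots> = (\<integral>\<^sup>+ u. ennreal \<bar>m.I u - m'.I u\<bar> \<partial>\<Omega>)"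
      unfolding \<pi>_def by (subst nn_integral_distr) auto
    also have "\<dots> = (\<integral>\<^sup>+ t. emeasure \<Omega> {u \<in> space \<Omega>. m.I u \<le> t \<and> t < m'.I u} +
             emeasure \<Omega> {u \<in> space \<Omega>. m'.I u \<le> t \<and> t < m.I u} \<partial>lborel)"
      by (rule nn_integral_abs_diff_layers) (auto intro: \<Omega>.sigma_finite_measure_axioms)
    also have "\<dots> \<le> (\<integral>\<^sup>+ t. ennreal \<bar>cdf m t - cdf m' t\<bar> \<partial>lborel)"
    proof (intro nn_integral_mono)
      fix t
      \<comment> \<open>Quantile and distribution function form a Galois connection: the u in (0,1) with
      m-quantile at most t are those with u at most F(t).\<close>
      have "emeasure \<Omega> {u \<in> space \<Omega>. m.I u \<le> t \<and> t < m'.I u} \<le> emeasure lborel {cdf m' t<..cdf m t}"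
        unfolding \<Omega>_def
        by (subst emeasure_restrict_space)
          (auto simp: space_restrict_space m.pseudoinverse[symmetric] m'.pseudoinverse[symmetric]
            not_le[symmetric] intro!: emeasure_mono)
      moreover have "emeasure \<Omega> {u \<in> space \<Omega>. m'.I u \<le> t \<and> t < m.I u} \<le> emeasure lborel {cdf m t<..cdf m' t}"
        unfolding \<Omega>_def
        by (subst emeasure_restrict_space)
          (auto simp: space_restrict_space m.pseudoinverse[symmetric] m'.pseudoinverse[symmetric]
            not_le[symmetric] intro!: emeasure_mono)
      ultimately show "emeasure \<Omega> {u \<in> space \<Omega>. m.I u \<le> t \<and> t < m'.I u} +
             emeasure \<Omega> {u \<in> space \<Omega>. m'.I u \<le> t \<and> t < m.I u} \<le> ennreal \<bar>cdf m t - cdf m' t\<bar>"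
        by (cases "cdf m t \<le> cdf m' t") (auto dest: add_mono)
    qed
    finally show ?thesis .
  qed
qed

section \<open>The distribution function of the empirical measure\<close>

definition nearest_int_dist :: "real \<Rightarrow> real" where
  "nearest_int_dist v = \<bar>v - of_int (round v)\<bar>"

lemma nearest_int_dist_bounds: "0 \<le> nearest_int_dist v" "nearest_int_dist v \<le> 1 / 2"
  using of_int_round_abs_le[of v] by (auto simp: nearest_int_dist_def abs_minus_commute)

lemma nearest_int_dist_of_nat [simp]: "nearest_int_dist (real n) = 0"
  by (simp add: nearest_int_dist_def)

lemma nearest_int_dist_0 [simp]: "nearest_int_dist 0 = 0"
  by (simp add: nearest_int_dist_def)

lemma nearest_int_dist_le: "nearest_int_dist v \<le> \<bar>v - of_int k\<bar>"
  unfolding nearest_int_dist_def by (rule round_diff_minimal)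

lemma borel_measurable_nearest_int_dist [measurable]: "nearest_int_dist \<in> borel_measurable borel"
  unfolding nearest_int_dist_def[abs_def] round_def by measurable

text \<open>
Under a shift by half a period the deviation from the mean \<open>1 / 4\<close> changes its sign, so averaging the
function with its shift removes the oscillation.
\<close>

lemma nearest_int_dist_add_half: "nearest_int_dist v + nearest_int_dist (v + 1 / 2) = 1 / 2"
proof -
  have next_round: "round (v + 1 / 2) = \<lfloor>v\<rfloor> + 1"
    by (simp add: round_def add.assoc)
  show ?thesis
  proof (cases "v < of_int \<lfloor>v\<rfloor> + 1 / 2")
    case True
    then have "round v = \<lfloor>v\<rfloor>" by (intro round_unique) linarith+
    with True show ?thesis unfolding nearest_int_dist_def next_round by simp
  next
    case False
    then have "round v = \<lfloor>v\<rfloor> + 1" by (intro round_unique) (simp, linarith?)+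
    with False show ?thesis unfolding nearest_int_dist_def next_round by simp
  qed
qed

text \<open>
Since \<open>d \<le> 1 / 2\<close>, the square is at most \<open>d / 2\<close>, and \<open>d\<close> is at most the distance of \<open>n p\<close> to either
of the integers 0 and \<open>n\<close>.
\<close>

lemma nearest_int_dist_sq_le:
  assumes "0 \<le> p" "p \<le> 1"
  shows "(nearest_int_dist (real n * p))\<^sup>2 \<le> real n * (p * (1 - p))"
proof -
  let ?d = "nearest_int_dist (real n * p)"
  have d: "0 \<le> ?d" "?d \<le> 1 / 2" "?d \<le> real n * p" "?d \<le> real n * (1 - p)"
    using nearest_int_dist_bounds[of "real n * p"] nearest_int_dist_le[of "real n * p" 0] 
      nearest_int_dist_le[of "real n * p" "int n"] assms mult_left_mono[of p 1 "real n"]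
    by (auto simp: algebra_simps)
  have "?d\<^sup>2 \<le> ?d * (1 / 2)"
    unfolding power2_eq_square using d by (intro mult_left_mono) auto
  also have "\<dots> \<le> real n * (p * (1 - p))"
  \<comment> \<open>Bound the distance by the one of np, n(1-p) that belongs to the smaller of p, 1-p;
    the other of these two factors is then at least 1/2.\<close>
  proof (cases "p \<le> 1 / 2")
    case True
    have "?d * (1 / 2) \<le> (real n * p) * (1 - p)"
      using d True assms by (intro mult_mono) auto
    then show ?thesis by (simp add: mult.assoc)
  next
    case False
    have "?d * (1 / 2) \<le> (real n * (1 - p)) * p"
      using d False assms by (intro mult_mono) auto
    then show ?thesis by (simp add: mult_ac)
  qed
  finally show ?thesis .
qed

text \<open>
The value at \<open>t\<close> is \<open>1 / n\<close> times the number of \<open>k \<in> {1..n}\<close> with \<open>(2 k - 1) / (2 n) \<le> F t\<close>, that is,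
with \<open>k \<le> n F t + 1 / 2\<close>: the midpoints \<open>(2 k - 1) / (2 n)\<close> are where rounding to a multiple of \<open>1 / n\<close> jumps.
\<close>

lemma cdf_quantile_empirical:
  assumes "real_distribution m" and n: "n \<ge> 1"
  shows "cdf (quantile_empirical m n) t = of_int (round (real n * cdf m t)) / real n"
proof -
  interpret m: cdf_distribution m using assms(1) by (simp add: cdf_distribution_def)
  define p where "p = cdf m t"
  have p: "0 \<le> p" "p \<le> 1" by (simp_all add: p_def m.cdf_nonneg m.cdf_bounded_prob)
  define r where "r = nat (round (real n * p))"
  have r0: "0 \<le> round (real n * p)" using round_mono[of 0 "real n * p"] p by simp
  have rn: "r \<le> n"
    using round_mono[of "real n * p" "real n"] p mult_left_mono[of p 1 "real n"]
    by (simp add: r_def nat_le_iff)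
  have node: "quantile_node m n k \<le> t \<longleftrightarrow> k \<le> r" if k: "k \<in> {1..n}" for k
  proof -
    have "quantile_node m n k \<le> t \<longleftrightarrow> real (2 * k - 1) / real (2 * n) \<le> p"
      unfolding quantile_node_def quantile_def p_def
      using k n by (intro m.pseudoinverse[symmetric]) (auto simp: field_simps of_nat_diff)
    also have "\<dots> \<longleftrightarrow> of_int (int k) \<le> real n * p + 1 / 2"
      using k n by (auto simp: field_simps of_nat_diff)
    also have "\<dots> \<longleftrightarrow> int k \<le> round (real n * p)"
      unfolding round_def by (rule le_floor_iff[symmetric])
    also have "\<dots> \<longleftrightarrow> k \<le> r" using r0 by (simp add: r_def le_nat_iff)
    finally show ?thesis .
  qed
  have "(\<Sum>k=1..n. emeasure (return borel (quantile_node m n k)) {..t}) =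
      (\<Sum>k=1..n. if k \<le> r then 1 else 0 :: ennreal)"
    by (intro sum.cong) (auto simp: node)
  also have "\<dots> = of_nat (card {k \<in> {1..n}. k \<le> r})"
    by (simp flip: sum.inter_filter)
  also have "{k \<in> {1..n}. k \<le> r} = {1..r}" using rn by auto
  finally have "emeasure (quantile_empirical m n) {..t} = ennreal (1 / real n) * ennreal (real r)"
    by (simp add: emeasure_quantile_empirical ennreal_of_nat_eq_real_of_nat)
  also have "\<dots> = ennreal (real r / real n)"
    by (simp add: ennreal_mult[symmetric])
  finally have "measure (quantile_empirical m n) {..t} = real r / real n"
    by (simp add: measure_def)
  then show ?thesis
    using r0 by (simp add: cdf_def r_def p_def[unfolded cdf_def, symmetric])
qed

lemma W1_quantile_empirical:
  assumes m: "real_distribution m" and n: "n \<ge> 1"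
  shows "W1 m (quantile_empirical m n) =
    (\<integral>\<^sup>+ t. ennreal (nearest_int_dist (real n * cdf m t) / real n) \<partial>lborel)"
proof -
  have "\<bar>cdf m t - cdf (quantile_empirical m n) t\<bar> = nearest_int_dist (real n * cdf m t) / real n" for t
  proof -
    have "cdf m t - cdf (quantile_empirical m n) t =
        (real n * cdf m t - of_int (round (real n * cdf m t))) / real n"
      using n by (simp add: cdf_quantile_empirical[OF m n] diff_divide_distrib)
    then show ?thesis by (simp add: nearest_int_dist_def)
  qed
  then show ?thesis
    by (simp add: W1_eq_nn_integral_cdf[OF m real_distribution_quantile_empirical[OF n]])
qed

section \<open>Bounds for a fixed number of nodes\<close>

lemma W1_quantile_empirical_le_sqrt:
  assumes m: "real_distribution m" and n: "n \<ge> 1"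
  shows "W1 m (quantile_empirical m n) \<le>
        ennreal (1 / sqrt (real n)) * (\<integral>\<^sup>+ x. ennreal (sqrt (cdf m x * (1 - cdf m x))) \<partial>lborel)"
proof -
  interpret m: cdf_distribution m using m by (simp add: cdf_distribution_def)
  have "W1 m (quantile_empirical m n) =
      (\<integral>\<^sup>+ t. ennreal (nearest_int_dist (real n * cdf m t) / real n) \<partial>lborel)"
    by (rule W1_quantile_empirical[OF m n])
  also have "\<dots> \<le> (\<integral>\<^sup>+ x. ennreal (1 / sqrt (real n)) * ennreal (sqrt (cdf m x * (1 - cdf m x))) \<partial>lborel)"
  proof (intro nn_integral_mono)
    fix t
    let ?p = "cdf m t"
    have "nearest_int_dist (real n * ?p) \<le> sqrt (real n * (?p * (1 - ?p)))"
      by (intro real_le_rsqrt nearest_int_dist_sq_le m.cdf_nonneg m.cdf_bounded_prob)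
    then have "nearest_int_dist (real n * ?p) / real n \<le> sqrt (real n) * sqrt (?p * (1 - ?p)) / real n"
      by (simp add: real_sqrt_mult divide_right_mono)
    also have "\<dots> = 1 / sqrt (real n) * sqrt (?p * (1 - ?p))"
      using n by (simp add: real_div_sqrt field_simps)
    finally show "ennreal (nearest_int_dist (real n * ?p) / real n) \<le> ennreal (1 / sqrt (real n)) * ennreal (sqrt (?p * (1 - ?p)))"
      using m.cdf_nonneg[of t] m.cdf_bounded_prob[of t] by (simp add: ennreal_mult[symmetric] ennreal_leI)
  qed
  also have "\<dots> = ennreal (1 / sqrt (real n)) * (\<integral>\<^sup>+ x. ennreal (sqrt (cdf m x * (1 - cdf m x))) \<partial>lborel)"
    by (rule nn_integral_cmult) measurable
  finally show ?thesis .
qed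

lemma cdf_outside_support:
  assumes "real_distribution m" and ab: "measure m {a..b} = 1"
  shows "t < a \<Longrightarrow> cdf m t = 0" "b \<le> t \<Longrightarrow> cdf m t = 1"
proof -
  interpret m: real_distribution m by fact
  have "cdf m t \<le> 0" if "t < a"
  proof -
    have "cdf m t + measure m {a..b} = measure m ({..t} \<union> {a..b})"
      unfolding cdf_def using that by (intro m.finite_measure_Union[symmetric]) auto
    then show ?thesis using m.prob_le_1[of "{..t} \<union> {a..b}"] ab by linarith
  qed
  then show "t < a \<Longrightarrow> cdf m t = 0" using m.cdf_nonneg[of t] by simp
  assume "b \<le> t"
  then have "measure m {a..b} \<le> cdf m t"
    unfolding cdf_def by (intro m.finite_measure_mono) auto
  then show "cdf m t = 1" using ab m.cdf_bounded_prob[of t] by simp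
qed

lemma nearest_int_dist_cdf_outside_support:
  assumes "real_distribution m" "measure m {a..b} = 1" "t \<notin> {a..b}"
  shows "nearest_int_dist (real n * cdf m t) = 0"
proof (cases "t < a")
  case False
  then have "b \<le> t" using assms(3) by simp
  then show ?thesis using cdf_outside_support(2)[OF assms(1,2)] by simp
qed (simp add: cdf_outside_support(1)[OF assms(1,2)])

lemma W1_quantile_empirical_le_support:
  assumes m: "real_distribution m" and n: "n \<ge> 1" and "a < b" and ab: "measure m {a..b} = 1"
  shows "W1 m (quantile_empirical m n) \<le> ennreal ((b - a) / (2 * real n))"
proof -
  have "W1 m (quantile_empirical m n) =
      (\<integral>\<^sup>+ t. ennreal (nearest_int_dist (real n * cdf m t) / real n) \<partial>lborel)"
    by (rule W1_quantile_empirical[OF m n])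
  also have "\<dots> \<le> (\<integral>\<^sup>+ t. ennreal (1 / (2 * real n)) * indicator {a..b} t \<partial>lborel)"
  proof (intro nn_integral_mono)
    fix t
    have "nearest_int_dist (real n * cdf m t) / real n \<le> 1 / 2 / real n"
      by (intro divide_right_mono nearest_int_dist_bounds) simp
    then show "ennreal (nearest_int_dist (real n * cdf m t) / real n) \<le> ennreal (1 / (2 * real n)) * indicator {a..b} t"
      using nearest_int_dist_cdf_outside_support[OF m ab, of t n]
      by (cases "t \<in> {a..b}") (auto intro: ennreal_leI)
  qed
  also have "\<dots> = ennreal ((b - a) / (2 * real n))"
    using \<open>a < b\<close> by (simp add: nn_integral_cmult_indicator ennreal_mult[symmetric])
  finally show ?thesis .
qed

section \<open>Convergence and the first moment\<close>

text \<open>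
The first moment is the cost of moving \<open>m\<close> to the Dirac mass at 0; the mass carried across level \<open>t\<close> is
\<open>F t\<close> below 0 and \<open>1 - F t\<close> from 0 on.
\<close>

lemma nn_integral_abs_eq_cdf:
  assumes "real_distribution m"
  shows "(\<integral>\<^sup>+ x. ennreal \<bar>x\<bar> \<partial>m) = (\<integral>\<^sup>+ t. ennreal \<bar>cdf m t - indicator {0..} t\<bar> \<partial>lborel)"
proof -
  interpret m: cdf_distribution m using assms(1) by (simp add: cdf_distribution_def)
  have "(\<integral>\<^sup>+ x. ennreal \<bar>x\<bar> \<partial>m) = (\<integral>\<^sup>+ x. ennreal \<bar>x - 0\<bar> \<partial>m)" by simp
  also have "\<dots> = (\<integral>\<^sup>+ t. emeasure m {x \<in> space m. x \<le> t \<and> t < 0} +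
             emeasure m {x \<in> space m. 0 \<le> t \<and> t < x} \<partial>lborel)"
    by (rule nn_integral_abs_diff_layers) (auto intro: m.sigma_finite_measure_axioms)
  also have "\<dots> = (\<integral>\<^sup>+ t. ennreal \<bar>cdf m t - indicator {0..} t\<bar> \<partial>lborel)"
  proof (intro nn_integral_cong)
    fix t :: real
    show "emeasure m {x \<in> space m. x \<le> t \<and> t < 0} + emeasure m {x \<in> space m. 0 \<le> t \<and> t < x} =
        ennreal \<bar>cdf m t - indicator {0..} t\<bar>"
    proof (cases "t < 0")
      case True
      have "{x. x \<le> t} = {..t}" by auto
      with True show ?thesis
        by (simp add: m.borel_UNIV cdf_def m.emeasure_eq_measure)
    next
      case False
      have "measure m {t<..} = 1 - cdf m t"
        using m.prob_compl[of "{..t}"] by (simp add: m.borel_UNIV cdf_def Compl_atMost Compl_eq_Diff_UNIV[symmetric])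
      moreover have "{x. t < x} = {t<..}" by auto
      ultimately show ?thesis using False m.cdf_bounded_prob[of t]
        by (simp add: m.borel_UNIV m.emeasure_eq_measure)
    qed
  qed
  finally show ?thesis .
qed

lemma W1_quantile_empirical_tendsto_0_iff:
  assumes m: "real_distribution m"
  shows "(\<lambda>n. W1 m (quantile_empirical m n)) \<longlonglongrightarrow> 0 \<longleftrightarrow> (\<integral>\<^sup>+ x. ennreal \<bar>x\<bar> \<partial>m) < \<infinity>"
proof
  interpret m: cdf_distribution m using m by (simp add: cdf_distribution_def)
  {
    assume "(\<lambda>n. W1 m (quantile_empirical m n)) \<longlonglongrightarrow> 0"
    then have "\<forall>\<^sub>F n in sequentially. W1 m (quantile_empirical m n) < 1"
      by (rule order_tendstoD) simp
    then have "\<forall>\<^sub>F n in sequentially. W1 m (quantile_empirical m n) < 1 \<and> n \<ge> 1"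
      using eventually_ge_at_top by (rule eventually_conj)
    then obtain n where n: "W1 m (quantile_empirical m n) < 1" "n \<ge> 1"
      using eventually_happens'[OF sequentially_bot] by blast
    have "\<forall>\<^sub>F t in at_bot. cdf m t < 1 / (2 * real n)"
      using m.cdf_lim_at_bot by (rule order_tendstoD) (use n in simp)
    then obtain a where a: "\<And>t. t \<le> a \<Longrightarrow> cdf m t < 1 / (2 * real n)"
      by (auto simp: eventually_at_bot_linorder)
    have "\<forall>\<^sub>F t in at_top. 1 - 1 / (2 * real n) < cdf m t"
      using m.cdf_lim_at_top_prob by (rule order_tendstoD) (use n in simp)
    then obtain b where b: "\<And>t. b \<le> t \<Longrightarrow> 1 - 1 / (2 * real n) < cdf m t"
      by (auto simp: eventually_at_top_linorder)
    \<comment> \<open>Outside [-M, M] the value nF(t) lies within 1/2 of 0 or of n, so the integrand for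
    this n coincides with that of the first moment; inside, the latter is at most 1.\<close>
    define M where "M = max \<bar>a\<bar> \<bar>b\<bar>"
    have "(\<integral>\<^sup>+ x. ennreal \<bar>x\<bar> \<partial>m) = (\<integral>\<^sup>+ t. ennreal \<bar>cdf m t - indicator {0..} t\<bar> \<partial>lborel)"
      by (rule nn_integral_abs_eq_cdf[OF m])
    also have "\<dots> \<le> (\<integral>\<^sup>+ t. ennreal (nearest_int_dist (real n * cdf m t) / real n) + indicator {-M..M} t \<partial>lborel)"
    proof (intro nn_integral_mono)
      fix t
      let ?p = "cdf m t"
      have p: "0 \<le> ?p" "?p \<le> 1" by (simp_all add: m.cdf_nonneg m.cdf_bounded_prob)
      consider "t \<in> {-M..M}" | "t < -M" | "M < t" by fastforce
      then show "ennreal \<bar>?p - indicator {0..} t\<bar> \<le>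
          ennreal (nearest_int_dist (real n * ?p) / real n) + indicator {-M..M} t"
      proof cases
        case 1
        have "\<bar>?p - indicator {0..} t\<bar> \<le> 1" using p by (auto simp: indicator_def)
        then have "ennreal \<bar>?p - indicator {0..} t\<bar> \<le> 1" by (simp add: ennreal_le_1)
        then show ?thesis using 1 by (simp add: add_increasing)
      next
        case 2
        then have "t \<le> a" "t < 0" by (auto simp: M_def)
        then have "round (real n * ?p) = 0"
          using a[of t] n p by (intro round_unique') (auto simp: field_simps abs_mult)
        then show ?thesis using n p 2 \<open>t < 0\<close> by (simp add: nearest_int_dist_def)
      next
        case 3
        then have "b \<le> t" "0 \<le> t" by (auto simp: M_def)
        have "\<bar>real n * ?p - real n\<bar> = real n * (1 - ?p)"
          using p n mult_left_mono[OF p(2), of "real n"] by (simp add: algebra_simps)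
        moreover have "real n * (1 - ?p) < 1 / 2"
          using b[OF \<open>b \<le> t\<close>] n by (simp add: field_simps)
        ultimately have "round (real n * ?p) = int n" "\<bar>real n * ?p - real n\<bar> = real n * (1 - ?p)"
          by (auto intro: round_unique')
        then have "nearest_int_dist (real n * ?p) / real n = 1 - ?p"
          using n by (simp add: nearest_int_dist_def)
        then show ?thesis using p 3 \<open>0 \<le> t\<close> by simp
      qed
    qed
    also have "\<dots> = W1 m (quantile_empirical m n) + emeasure lborel {-M..M}"
      by (subst nn_integral_add) (auto simp: W1_quantile_empirical[OF m n(2)])
    also have "\<dots> < \<infinity>"
      using n by (auto simp: emeasure_lborel_Icc_eq ennreal_add_less_top intro: less_trans)
    finally show "(\<integral>\<^sup>+ x. ennreal \<bar>x\<bar> \<partial>m) < \<infinity>" .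
  }
  assume moment: "(\<integral>\<^sup>+ x. ennreal \<bar>x\<bar> \<partial>m) < \<infinity>"
  have "(\<lambda>n. \<integral>\<^sup>+ t. ennreal (nearest_int_dist (real n * cdf m t) / real n) \<partial>lborel) \<longlonglongrightarrow> (\<integral>\<^sup>+ t. 0 \<partial>(lborel :: real measure))"
  proof (rule nn_integral_dominated_convergence[where w="\<lambda>t. ennreal \<bar>cdf m t - indicator {0..} t\<bar>"])
    show "(\<integral>\<^sup>+ t. ennreal \<bar>cdf m t - indicator {0..} t\<bar> \<partial>lborel) < \<infinity>"
      using moment by (simp add: nn_integral_abs_eq_cdf[OF m])
    show "AE t in lborel. ennreal (nearest_int_dist (real n * cdf m t) / real n) \<le> ennreal \<bar>cdf m t - indicator {0..} t\<bar>" for n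
    proof (intro AE_I2 ennreal_leI)
      fix t
      let ?p = "cdf m t"
      have p: "0 \<le> ?p" "?p \<le> 1" by (simp_all add: m.cdf_nonneg m.cdf_bounded_prob)
      show "nearest_int_dist (real n * ?p) / real n \<le> \<bar>?p - indicator {0..} t\<bar>"
      proof (cases "n = 0")
        case False
        \<comment> \<open>Compare with the integers 0 and n.\<close>
        have "nearest_int_dist (real n * ?p) \<le> \<bar>real n * ?p - of_int (indicator {0..} t * int n)\<bar>"
          by (rule nearest_int_dist_le)
        also have "real n * ?p - of_int (indicator {0..} t * int n) = real n * (?p - indicator {0..} t)"
          by (simp add: indicator_def algebra_simps)
        also have "\<bar>\<dots>\<bar> = real n * \<bar>?p - indicator {0..} t\<bar>"
          by (simp add: abs_mult)
        finally show ?thesis using False by (simp add: field_simps)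
      qed simp
    qed
    show "AE t in lborel. (\<lambda>n. ennreal (nearest_int_dist (real n * cdf m t) / real n)) \<longlonglongrightarrow> 0"
    proof (intro AE_I2)
      fix t
      have "(\<lambda>n. nearest_int_dist (real n * cdf m t) / real n) \<longlonglongrightarrow> 0"
      proof (rule tendsto_sandwich[OF _ _ tendsto_const lim_1_over_n])
        show "\<forall>\<^sub>F n in sequentially. nearest_int_dist (real n * cdf m t) / real n \<le> 1 / real n"
          using order_trans[OF nearest_int_dist_bounds(2), of 1]
          by (intro always_eventually allI divide_right_mono) auto
      qed (simp add: nearest_int_dist_bounds)
      then show "(\<lambda>n. ennreal (nearest_int_dist (real n * cdf m t) / real n)) \<longlonglongrightarrow> 0"
        using tendsto_ennrealI[of _ 0] by fastforce
    qed
  qed simp_all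
  then have lim: "(\<lambda>n. \<integral>\<^sup>+ t. ennreal (nearest_int_dist (real n * cdf m t) / real n) \<partial>lborel) \<longlonglongrightarrow> 0"
    by simp
  show "(\<lambda>n. W1 m (quantile_empirical m n)) \<longlonglongrightarrow> 0"
    by (rule Lim_transform_eventually[OF lim])
      (auto intro: eventually_sequentiallyI[of 1] simp: W1_quantile_empirical[OF m])
qed

section \<open>Equidistribution\<close>

lemma integrable_mult_bounded_real:
  fixes g \<psi> :: "'a \<Rightarrow> real"
  assumes g: "integrable M g" and "\<psi> \<in> borel_measurable M" and bound: "\<And>x. \<bar>\<psi> x\<bar> \<le> C"
  shows "integrable M (\<lambda>x. g x * \<psi> x)"
proof (rule Bochner_Integration.integrable_bound[where f="\<lambda>x. C * g x"])
  have C: "0 \<le> C" using bound[of undefined] by linarith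
  show "integrable M (\<lambda>x. C * g x)" using g by simp
  show "(\<lambda>x. g x * \<psi> x) \<in> borel_measurable M"
    using borel_measurable_integrable[OF g] assms(2) by measurable
  show "AE x in M. norm (g x * \<psi> x) \<le> norm (C * g x)"
    using bound C by (auto simp: abs_mult mult.commute[of "\<bar>g _\<bar>"] intro!: mult_right_mono)
qed

text \<open>
Uniformly bounded kernels define equicontinuous functionals on \<open>L\<^sup>1\<close>, so the functions on which they
converge to 0 form a closed set.
\<close>

lemma tendsto_integral_mult_L1_limit:
  fixes \<psi> :: "nat \<Rightarrow> 'a \<Rightarrow> real"
  assumes [measurable]: "\<And>n. \<psi> n \<in> borel_measurable M"
    and bound: "\<And>n x. \<bar>\<psi> n x\<bar> \<le> C"
    and s: "\<And>i. integrable M (s i)" and h: "integrable M h"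
    and L1: "(\<lambda>i. \<integral>x. \<bar>s i x - h x\<bar> \<partial>M) \<longlonglongrightarrow> 0"
    and lim: "\<And>i. (\<lambda>n. \<integral>x. s i x * \<psi> n x \<partial>M) \<longlonglongrightarrow> 0"
  shows "(\<lambda>n. \<integral>x. h x * \<psi> n x \<partial>M) \<longlonglongrightarrow> 0"
proof (rule tendstoI)
  fix e :: real assume e: "0 < e"
  have C: "0 \<le> C" using bound[of 0 undefined] by linarith
  \<comment> \<open>C + 1 instead of C avoids dividing by zero when the kernels vanish.\<close>
  have "\<forall>\<^sub>F i in sequentially. (\<integral>x. \<bar>s i x - h x\<bar> \<partial>M) < e / (2 * (C + 1))"
    using e C by (intro order_tendstoD[OF L1]) auto
  then obtain i where i: "(\<integral>x. \<bar>s i x - h x\<bar> \<partial>M) < e / (2 * (C + 1))"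
    using eventually_happens'[OF sequentially_bot] by blast
  have intg: "integrable M (\<lambda>x. g x * \<psi> n x)" if "integrable M g" for g n
    using that by (rule integrable_mult_bounded_real[where C=C]) (simp_all add: bound)
  have "\<forall>\<^sub>F n in sequentially. \<bar>\<integral>x. s i x * \<psi> n x \<partial>M\<bar> < e / 2"
    using tendstoD[OF lim[of i], of "e / 2"] e by simp
  then show "\<forall>\<^sub>F n in sequentially. dist (\<integral>x. h x * \<psi> n x \<partial>M) 0 < e"
  proof eventually_elim
    case (elim n)
    have "\<bar>(\<integral>x. s i x * \<psi> n x \<partial>M) - (\<integral>x. h x * \<psi> n x \<partial>M)\<bar>
        = \<bar>\<integral>x. (s i x - h x) * \<psi> n x \<partial>M\<bar>"
      using intg[OF s[of i], of n] intg[OF h, of n] by (simp add: left_diff_distrib)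
    also have "\<dots> \<le> (\<integral>x. \<bar>(s i x - h x) * \<psi> n x\<bar> \<partial>M)"
      by (rule integral_abs_bound)
    also have "\<dots> \<le> (\<integral>x. (C + 1) * \<bar>s i x - h x\<bar> \<partial>M)"
    proof (rule integral_mono)
      show "integrable M (\<lambda>x. \<bar>(s i x - h x) * \<psi> n x\<bar>)"
        using intg[of "\<lambda>x. s i x - h x" n] s[of i] h by (intro integrable_abs) simp
      show "integrable M (\<lambda>x. (C + 1) * \<bar>s i x - h x\<bar>)"
        using s[of i] h by simp
      show "\<bar>(s i x - h x) * \<psi> n x\<bar> \<le> (C + 1) * \<bar>s i x - h x\<bar>" for x
        using mult_left_mono[OF bound[of n x] abs_ge_zero[of "s i x - h x"]]
        by (simp add: abs_mult distrib_right mult.commute[of C] add_increasing2)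
    qed
    also have "\<dots> = (C + 1) * (\<integral>x. \<bar>s i x - h x\<bar> \<partial>M)" by simp
    also have "\<dots> < e / 2" using i C by (simp add: field_simps)
    finally have "\<bar>(\<integral>x. s i x * \<psi> n x \<partial>M) - (\<integral>x. h x * \<psi> n x \<partial>M)\<bar> < e / 2" .
    moreover have "\<bar>x\<bar> < e" if "\<bar>y - x\<bar> < e / 2" "\<bar>y\<bar> < e / 2" for x y :: real
      using that by linarith
    ultimately show ?case using elim by (simp only: dist_real_def diff_zero)
  qed
qed

text \<open>
A Dynkin argument passes from the generator to all measurable sets, and the density of simple functions
in \<open>L\<^sup>1\<close> from there to all integrable functions. Both countable unions and limits of simple functions
are limits in \<open>L\<^sup>1\<close>.
\<close>

lemma tendsto_integral_mult_pi_system: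
  fixes \<psi> :: "nat \<Rightarrow> 'a \<Rightarrow> real"
  assumes "finite_measure M"
    and G: "Int_stable G" "G \<subseteq> Pow (space M)" "sets M = sigma_sets (space M) G"
    and meas[measurable]: "\<And>n. \<psi> n \<in> borel_measurable M"
    and bound: "\<And>n x. \<bar>\<psi> n x\<bar> \<le> C"
    and total: "(\<lambda>n. \<integral>x. \<psi> n x \<partial>M) \<longlonglongrightarrow> 0"
    and gen: "\<And>A. A \<in> G \<Longrightarrow> (\<lambda>n. \<integral>x. indicator A x * \<psi> n x \<partial>M) \<longlonglongrightarrow> 0"
    and h: "integrable M h"
  shows "(\<lambda>n. \<integral>x. h x * \<psi> n x \<partial>M) \<longlonglongrightarrow> 0"
proof -
  interpret finite_measure M by fact
  have int_\<psi>: "integrable M (\<psi> n)" for n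
    using bound by (intro integrable_const_bound[where B=C]) auto
  have intg: "integrable M (\<lambda>x. g x * \<psi> n x)" if "integrable M g" for g :: "'a \<Rightarrow> real" and n
    using that by (rule integrable_mult_bounded_real[where C=C]) (simp_all add: bound)
  have sets: "(\<lambda>n. \<integral>x. indicator A x * \<psi> n x \<partial>M) \<longlonglongrightarrow> 0" if "A \<in> sets M" for A
    using G(1,2) that[unfolded G(3)]
  proof (induction rule: sigma_sets_induct_disjoint)
    case (basic A)
    then show ?case by (rule gen)
  next
    case empty
    show ?case by simp
  next
    case (compl A)
    then have A[measurable]: "A \<in> sets M" by (simp add: G(3))
    have "(\<integral>x. indicator (space M - A) x * \<psi> n x \<partial>M) =
        (\<integral>x. \<psi> n x \<partial>M) - (\<integral>x. indicator A x * \<psi> n x \<partial>M)" for n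
    proof -
      have "(\<integral>x. indicator (space M - A) x * \<psi> n x \<partial>M) =
        (\<integral>x. \<psi> n x - indicator A x * \<psi> n x \<partial>M)"
        by (intro Bochner_Integration.integral_cong) (auto simp: indicator_def)
      also have "\<dots> = (\<integral>x. \<psi> n x \<partial>M) - (\<integral>x. indicator A x * \<psi> n x \<partial>M)"
        by (intro Bochner_Integration.integral_diff int_\<psi> intg) (auto simp: emeasure_eq_measure)
      finally show ?thesis .
    qed
    then show ?case using tendsto_diff[OF total compl(2)] by simp
  next
    case (union A)
    then have A[measurable]: "A i \<in> sets M" for i using G(3) by auto
    define B where "B k = (\<Union>i<k. A i)" for k
    have B[measurable]: "B k \<in> sets M" for k unfolding B_def by auto
    have B_ind: "indicator (B k) x = (\<Sum>i<k. indicator (A i) x :: real)" for k x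
      unfolding B_def using union(1)
      by (intro indicator_UN_disjoint) (auto simp: disjoint_family_on_def)
    show ?case
    proof (rule tendsto_integral_mult_L1_limit[where s="\<lambda>k. indicator (B k)" and C=C])
      show "(\<lambda>k. \<integral>x. \<bar>indicat_real (B k) x - indicator (\<Union> (range A)) x\<bar> \<partial>M) \<longlonglongrightarrow> 0"
      proof -
        have "(\<integral>x. \<bar>indicat_real (B k) x - indicator (\<Union> (range A)) x\<bar> \<partial>M) =
            measure M (\<Union> (range A)) - measure M (B k)" for k
        proof -
          have "(\<integral>x. \<bar>indicat_real (B k) x - indicator (\<Union> (range A)) x\<bar> \<partial>M) =
            (\<integral>x. indicat_real (\<Union> (range A)) x - indicator (B k) x \<partial>M)"
            by (intro Bochner_Integration.integral_cong) (auto simp: B_def split: split_indicator)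
          also have "\<dots> = measure M (\<Union> (range A)) - measure M (B k)"
            by (subst Bochner_Integration.integral_diff) (auto simp: emeasure_eq_measure)
          finally show ?thesis .
        qed
        moreover have "(\<lambda>k. measure M (B k)) \<longlonglongrightarrow> measure M (\<Union>k. B k)"
          by (rule finite_Lim_measure_incseq) (auto simp: incseq_def B_def, fastforce)
        moreover have "(\<Union>k. B k) = \<Union> (range A)" by (auto simp: B_def)
        ultimately show ?thesis
          using tendsto_diff[OF tendsto_const[of "measure M (\<Union> (range A))"]] by fastforce
      qed
      fix k
      have "(\<lambda>n. \<Sum>i<k. \<integral>x. indicator (A i) x * \<psi> n x \<partial>M) \<longlonglongrightarrow> (\<Sum>i<k. 0)"
        using union(3) by (intro tendsto_sum)
      moreover have "(\<integral>x. indicator (B k) x * \<psi> n x \<partial>M) =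
          (\<Sum>i<k. \<integral>x. indicator (A i) x * \<psi> n x \<partial>M)" for n
        unfolding B_ind sum_distrib_right
        by (intro Bochner_Integration.integral_sum intg) (auto simp: emeasure_eq_measure)
      ultimately show "(\<lambda>n. \<integral>x. indicator (B k) x * \<psi> n x \<partial>M) \<longlonglongrightarrow> 0" by simp
    qed (auto simp: bound emeasure_eq_measure)
  qed
  show ?thesis
    using h
  proof (induction rule: integrable_induct)
    case (base A c)
    from tendsto_mult_left[OF sets[OF base(1)], of c] show ?case
      by (simp add: mult_ac)
  next
    case (add f g)
    have "(\<integral>x. (f x + g x) * \<psi> n x \<partial>M) = (\<integral>x. f x * \<psi> n x \<partial>M) + (\<integral>x. g x * \<psi> n x \<partial>M)" for n
      using add intg by (simp add: distrib_right)
    then show ?case using tendsto_add[OF add(3,4)] by simp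
  next
    case (lim f s)
    show ?case
    proof (rule tendsto_integral_mult_L1_limit[OF meas bound lim(1,4) _ lim(5)])
      have "(\<lambda>i. \<integral>x. \<bar>s i x - f x\<bar> \<partial>M) \<longlonglongrightarrow> (\<integral>x. 0 \<partial>M)"
      proof (rule integral_dominated_convergence[where w="\<lambda>x. 3 * \<bar>f x\<bar>"])
        show "(\<lambda>x. \<bar>s i x - f x\<bar>) \<in> borel_measurable M" for i
          using lim(1)[of i] lim(4) by (intro borel_measurable_abs borel_measurable_diff) auto
        show "AE x in M. (\<lambda>i. \<bar>s i x - f x\<bar>) \<longlonglongrightarrow> 0"
          using lim(2) by (intro AE_I2 tendsto_rabs_zero) (auto intro: LIM_zero)
        show "AE x in M. norm \<bar>s i x - f x\<bar> \<le> 3 * \<bar>f x\<bar>" for i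
        proof (rule AE_I2)
          fix x assume "x \<in> space M"
          then show "norm \<bar>s i x - f x\<bar> \<le> 3 * \<bar>f x\<bar>"
            using lim(3)[of x i] by simp
        qed
      qed (use lim in auto)
      then show "(\<lambda>i. \<integral>x. \<bar>s i x - f x\<bar> \<partial>M) \<longlonglongrightarrow> 0" by simp
    qed
  qed
qed

text \<open>
Adding the same integral with the argument shifted by half a period gives exactly \<open>c / 2\<close>, and the
shift changes the integral only by \<open>O (1 / n)\<close>.
\<close>

lemma tendsto_integral_nearest_int_dist:
  assumes c: "0 \<le> c"
  shows "(\<lambda>n. \<integral>u. indicator {0..c} u * nearest_int_dist (real n * u) \<partial>lborel) \<longlonglongrightarrow> c / 4"
proof -
  let ?J = "\<lambda>n. \<integral>u. indicator {0..c} u * nearest_int_dist (real n * u) \<partial>lborel"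
  let ?K = "\<lambda>n. \<integral>u. indicator {0..c} u * nearest_int_dist (real n * u + 1 / 2) \<partial>lborel"
  have int: "integrable lborel (\<lambda>u. indicator {x..y} u * g u)"
    if [measurable]: "g \<in> borel_measurable borel" and "\<And>u. \<bar>g u\<bar> \<le> 1" for x y and g :: "real \<Rightarrow> real"
    using that by (intro integrable_mult_bounded_real[where C=1]) (simp_all add: emeasure_lborel_Icc_eq)
  have d1: "\<bar>nearest_int_dist v\<bar> \<le> 1" "nearest_int_dist v \<le> 1" for v using nearest_int_dist_bounds[of v] by auto
  have sum: "?J n + ?K n = c / 2" for n
  proof -
    have "?J n + ?K n = (\<integral>u. indicator {0..c} u * (1 / 2) \<partial>lborel)"
      by (subst Bochner_Integration.integral_add[symmetric])
        (auto intro!: int d1 simp: distrib_left[symmetric] nearest_int_dist_add_half)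
    then show ?thesis using c by simp
  qed
  have close: "\<bar>?J n - ?K n\<bar> \<le> 1 / real n" if n: "n \<ge> 1" for n
  proof -
    \<comment> \<open>Half a period in v = nu is a shift by s in u, so the two integrals can only differ
    near the two ends of the interval.\<close>
    define s where "s = 1 / (2 * real n)"
    have s: "0 \<le> s" "real n * s = 1 / 2" using n by (auto simp: s_def)
    have shift: "real n * (s + u) = real n * u + 1 / 2" for u
      using s(2) by (simp add: distrib_left)
    have "?K n = (\<integral>u. indicator {s..c + s} (s + 1 * u) * nearest_int_dist (real n * (s + 1 * u)) \<partial>lborel)"
      using s(1) by (intro Bochner_Integration.integral_cong) (auto simp: indicator_def shift)
    also have "\<dots> = (\<integral>u. indicator {s..c + s} u * nearest_int_dist (real n * u) \<partial>lborel)"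
      using lborel_integral_real_affine[of 1 "\<lambda>u. indicator {s..c + s} u * nearest_int_dist (real n * u)" s] by simp
    finally have "\<bar>?J n - ?K n\<bar> = \<bar>\<integral>u. indicator {0..c} u * nearest_int_dist (real n * u) -
        indicator {s..c + s} u * nearest_int_dist (real n * u) \<partial>lborel\<bar>"
      by (subst Bochner_Integration.integral_diff) (auto intro!: int d1)
    also have "\<dots> \<le> (\<integral>u. \<bar>indicator {0..c} u * nearest_int_dist (real n * u) -
        indicator {s..c + s} u * nearest_int_dist (real n * u)\<bar> \<partial>lborel)"
      by (rule integral_abs_bound)
    also have "\<dots> \<le> (\<integral>u. indicator {0..s} u + indicator {c..c + s} u \<partial>lborel)"
    proof (rule integral_mono)
      show "integrable lborel (\<lambda>u. \<bar>indicator {0..c} u * nearest_int_dist (real n * u) -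
          indicator {s..c + s} u * nearest_int_dist (real n * u)\<bar>)"
        by (intro integrable_abs Bochner_Integration.integrable_diff int d1) simp_all
      show "integrable lborel (\<lambda>u. indicator {0..s} u + indicator {c..c + s} u :: real)"
        by (intro Bochner_Integration.integrable_add) (simp_all add: emeasure_lborel_Icc_eq)
      show "\<bar>indicator {0..c} u * nearest_int_dist (real n * u) - indicator {s..c + s} u * nearest_int_dist (real n * u)\<bar>
          \<le> indicator {0..s} u + indicator {c..c + s} u" for u
        using s(1) d1[of "real n * u"] by (auto split: split_indicator)
    qed
    also have "\<dots> = 1 / real n"
      using s by (subst Bochner_Integration.integral_add) (auto simp: emeasure_lborel_Icc_eq s_def)
    finally show ?thesis .
  qed
  have "(\<lambda>n. ?J n - ?K n) \<longlonglongrightarrow> 0"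
    using close by (intro tendsto_rabs_zero_cancel[OF tendsto_sandwich[OF _ _ tendsto_const lim_1_over_n]])
      (auto intro: eventually_sequentiallyI[of 1])
  then have "(\<lambda>n. ((?J n - ?K n) + (?J n + ?K n)) / 2) \<longlonglongrightarrow> (0 + c / 2) / 2"
    unfolding sum by (intro tendsto_intros) auto
  then show ?thesis by simp
qed

text \<open>
Without atoms \<open>F\<close> pushes \<open>m\<close> forward to the uniform distribution on the unit interval, and the half line
\<open>{..x}\<close> corresponds to the interval from 0 to \<open>F x\<close>. It is enough to test the deviations from the mean,
\<open>d (n F) - 1 / 4\<close>, on these half lines, which form a generator stable under intersections.
\<close>

lemma tendsto_integral_nearest_int_dist_cdf:
  assumes "real_distribution m" and atomless: "\<And>x. measure m {x} = 0" and h: "integrable m h"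
  shows "(\<lambda>n. \<integral>t. h t * nearest_int_dist (real n * cdf m t) \<partial>m) \<longlonglongrightarrow> (\<integral>t. h t \<partial>m) / 4"
proof -
  interpret m: cdf_distribution m using assms(1) by (simp add: cdf_distribution_def)
  define \<Omega> where "\<Omega> = restrict_space lborel {0<..<1::real}"
  have m_eq: "distr \<Omega> borel m.I = m"
    using m.distr_I_eq_M by (simp add: \<Omega>_def)
  have sets_\<Omega>: "sets \<Omega> = sets (restrict_space borel {0<..<1})"
    by (simp add: \<Omega>_def sets_restrict_space)
  have I_meas[measurable]: "m.I \<in> borel_measurable \<Omega>"
    using m.measurable_CI by (simp add: measurable_cong_sets[OF sets_\<Omega> refl])
  \<comment> \<open>Without atoms F is continuous, hence a left inverse of the quantile function.\<close>
  have F_I: "cdf m (m.I u) = u" if u: "0 < u" "u < 1" for u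
  proof (rule antisym)
    show "u \<le> cdf m (m.I u)" by (rule m.pseudoinverse[OF u, THEN iffD2]) (rule order_refl)
    have "isCont (cdf m) (m.I u)" using atomless by (simp add: m.isCont_cdf)
    then have "(cdf m \<longlongrightarrow> cdf m (m.I u)) (at_left (m.I u))"
      unfolding isCont_def by (rule filterlim_at_split[THEN iffD1, THEN conjunct1])
    moreover have "cdf m t \<le> u" if "t < m.I u" for t
      using m.pseudoinverse[OF u, of t] that by simp
    ultimately show "cdf m (m.I u) \<le> u"
      by (intro tendsto_upperbound[where F="at_left (m.I u)"])
        (auto simp: eventually_at_filter)
  qed
  define \<psi> where "\<psi> n t = nearest_int_dist (real n * cdf m t) - 1 / 4" for n t
  have \<psi>_meas[measurable]: "\<psi> n \<in> borel_measurable borel" for n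
    unfolding \<psi>_def by measurable
  have \<psi>_bound: "\<bar>\<psi> n t\<bar> \<le> 1" for n t
    using nearest_int_dist_bounds[of "real n * cdf m t"] by (auto simp: \<psi>_def)
  \<comment> \<open>For A = {..x} and c = F(x), and also for A = UNIV and c = 1, the quantile function
    turns the integral over A into a Lebesgue integral over an initial segment.\<close>
  have transfer: "(\<integral>t. indicator A t * \<psi> n t \<partial>m) =
      (\<integral>u. indicator {0..c} u * nearest_int_dist (real n * u) \<partial>lborel) - c / 4"
    if [measurable]: "A \<in> sets borel" and c: "0 \<le> c" "c \<le> 1"
      and A: "\<And>u. 0 < u \<Longrightarrow> u < 1 \<Longrightarrow> m.I u \<in> A \<longleftrightarrow> u \<le> c" for A c n
  proof -
    have "(\<integral>t. indicator A t * \<psi> n t \<partial>m) = (\<integral>t. indicator A t * \<psi> n t \<partial>distr \<Omega> borel m.I)"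
      by (simp add: m_eq)
    also have "\<dots> = (\<integral>u. indicator A (m.I u) * \<psi> n (m.I u) \<partial>\<Omega>)"
      by (rule integral_distr) auto
    also have "\<dots> = (\<integral>u. indicator {0<..<1} u *\<^sub>R (indicator A (m.I u) * \<psi> n (m.I u)) \<partial>lborel)"
      unfolding \<Omega>_def by (subst integral_restrict_space) auto
    also have "\<dots> = (\<integral>u. indicator {0<..<1} u * (indicator {0..c} u * (nearest_int_dist (real n * u) - 1 / 4)) \<partial>lborel)"
      by (intro Bochner_Integration.integral_cong) (auto simp: indicator_def A F_I \<psi>_def)
    also have "\<dots> = (\<integral>u. indicator {0..c} u * (nearest_int_dist (real n * u) - 1 / 4) \<partial>lborel)"
    proof (rule integral_cong_AE)
      show "AE u in lborel. indicator {0<..<1} u * (indicator {0..c} u * (nearest_int_dist (real n * u) - 1 / 4))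
          = indicator {0..c} u * (nearest_int_dist (real n * u) - 1 / 4)"
        using AE_lborel_singleton[of 0] AE_lborel_singleton[of 1]
        by eventually_elim (use c in \<open>auto simp: indicator_def\<close>)
    qed measurable
    also have "\<dots> = (\<integral>u. indicator {0..c} u * nearest_int_dist (real n * u) - indicator {0..c} u * (1 / 4) \<partial>lborel)"
      by (simp add: right_diff_distrib)
    also have "\<dots> = (\<integral>u. indicator {0..c} u * nearest_int_dist (real n * u) \<partial>lborel) - c / 4"
    proof (subst Bochner_Integration.integral_diff)
      show "integrable lborel (\<lambda>u. indicator {0..c} u * nearest_int_dist (real n * u))"
        using nearest_int_dist_bounds
        by (intro integrable_mult_bounded_real[where C="1 / 2"]) (simp_all add: emeasure_lborel_Icc_eq)
    qed (use c in \<open>auto simp: emeasure_lborel_Icc_eq\<close>)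
    finally show ?thesis .
  qed
  have "(\<lambda>n. \<integral>t. h t * \<psi> n t \<partial>m) \<longlonglongrightarrow> 0"
  proof (rule tendsto_integral_mult_pi_system[where G="range atMost" and C=1])
    show "Int_stable (range (atMost :: real \<Rightarrow> _))"
      by (auto simp: Int_stable_def)
    show "sets m = sigma_sets (space m) (range atMost)"
      using arg_cong[OF borel_eq_atMost, of sets] by (simp add: m.borel_UNIV)
    show "(\<lambda>n. \<integral>t. \<psi> n t \<partial>m) \<longlonglongrightarrow> 0"
      using tendsto_diff[OF tendsto_integral_nearest_int_dist[of 1] tendsto_const[of "1 / 4"]]
        transfer[of UNIV 1] by simp
    fix A :: "real set" assume "A \<in> range atMost"
    then obtain x where A: "A = {..x}" by auto
    show "(\<lambda>n. \<integral>t. indicator A t * \<psi> n t \<partial>m) \<longlonglongrightarrow> 0"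
      using tendsto_diff[OF tendsto_integral_nearest_int_dist[of "cdf m x"] tendsto_const[of "cdf m x / 4"]]
        transfer[of A "cdf m x"]
      by (simp add: A m.cdf_nonneg m.cdf_bounded_prob m.pseudoinverse[symmetric])
  qed (use h \<psi>_bound m.finite_measure_axioms in \<open>auto simp: m.borel_UNIV\<close>)
  moreover have "(\<integral>t. h t * nearest_int_dist (real n * cdf m t) \<partial>m) = (\<integral>t. h t * \<psi> n t \<partial>m) + (\<integral>t. h t \<partial>m) / 4" for n
  proof -
    have "integrable m (\<lambda>t. h t * \<psi> n t)"
      using \<psi>_bound by (intro integrable_mult_bounded_real[OF h, where C=1]) simp_all
    then have "(\<integral>t. h t * \<psi> n t + h t * (1 / 4) \<partial>m) = (\<integral>t. h t * \<psi> n t \<partial>m) + (\<integral>t. h t \<partial>m) / 4"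
      using h by simp
    then show ?thesis by (simp add: \<psi>_def algebra_simps)
  qed
  ultimately show ?thesis using tendsto_add[OF _ tendsto_const] by fastforce
qed

section \<open>The sharp rate for positive densities\<close>

text \<open>
Positivity of \<open>f\<close> makes Lebesgue measure on \<open>[a, b]\<close> absolutely continuous with respect to \<open>m\<close>, with
integrable density \<open>1 / f\<close>. This turns \<open>n W1\<close> into an integral over \<open>m\<close> to which equidistribution applies.
\<close>

lemma W1_quantile_empirical_density_asymp:
  fixes a b :: real
  assumes m: "real_distribution m" and "a < b" and f: "set_borel_measurable borel {a..b} f"
    and pos: "\<And>x. x \<in> {a..b} \<Longrightarrow> f x > 0"
    and m_eq: "m = density lborel (\<lambda>x. ennreal (indicator {a..b} x * f x))"
  shows "(\<lambda>n. of_nat n * W1 m (quantile_empirical m n)) \<longlonglongrightarrow> ennreal ((b - a) / 4)"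
proof -
  interpret m: cdf_distribution m using m by (simp add: cdf_distribution_def)
  define g where "g x = indicator {a..b} x * f x" for x
  have [measurable]: "g \<in> borel_measurable borel"
    using f by (simp add: set_borel_measurable_def g_def[abs_def])
  have m_g: "m = density lborel (\<lambda>x. ennreal (g x))" by (simp add: m_eq g_def)
  have g: "0 \<le> g x" "g x * inverse (g x) = indicator {a..b} x" for x
    using pos[of x] by (auto simp: g_def indicator_def)
  have g_outside: "g x = 0" if "x \<notin> {a..b}" for x
    using that by (simp add: g_def)
  \<comment> \<open>Since inverse 0 = 0, the function 1/g is supported in [a, b], where it is the
    density of Lebesgue measure with respect to m.\<close>
  have to_m: "(\<integral>\<^sup>+ t. ennreal (inverse (g t) * k t) \<partial>m) = (\<integral>\<^sup>+ t. ennreal (k t) * indicator {a..b} t \<partial>lborel)"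
    if [measurable]: "k \<in> borel_measurable borel" and k: "\<And>t. 0 \<le> k t" for k :: "real \<Rightarrow> real"
  proof -
    have "(\<integral>\<^sup>+ t. ennreal (inverse (g t) * k t) \<partial>m) = (\<integral>\<^sup>+ t. ennreal (g t) * ennreal (inverse (g t) * k t) \<partial>lborel)"
      unfolding m_g by (rule nn_integral_density) measurable
    also have "\<dots> = (\<integral>\<^sup>+ t. ennreal (k t) * indicator {a..b} t \<partial>lborel)"
    proof (intro nn_integral_cong)
      fix t
      have "ennreal (g t) * ennreal (inverse (g t) * k t) = ennreal (g t * (inverse (g t) * k t))"
        using g(1) k by (simp add: ennreal_mult)
      also have "\<dots> = ennreal (k t * indicator {a..b} t)"
        by (simp add: mult.assoc[symmetric] g(2) mult.commute)
      finally show "ennreal (g t) * ennreal (inverse (g t) * k t) = ennreal (k t) * indicator {a..b} t"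
        by (simp add: indicator_def)
    qed
    finally show ?thesis .
  qed
  have atomless: "measure m {x} = 0" for x
  proof -
    have "emeasure m {x} = (\<integral>\<^sup>+ t. ennreal (g t) * indicator {x} t \<partial>lborel)"
      unfolding m_g by (rule emeasure_density) auto
    also have "\<dots> = (\<integral>\<^sup>+ t. 0 \<partial>(lborel :: real measure))"
      by (intro nn_integral_cong_AE eventually_mono[OF AE_lborel_singleton[of x]]) auto
    finally show ?thesis by (simp add: measure_def)
  qed
  have "emeasure m {a..b} = emeasure m UNIV"
    unfolding m_g by (subst (1 2) emeasure_density)
      (auto intro!: nn_integral_cong simp: g_outside split: split_indicator)
  then have ab: "measure m {a..b} = 1"
    using m.prob_space by (simp add: measure_def m.borel_UNIV)
  have inv_nn: "(\<integral>\<^sup>+ t. ennreal (inverse (g t)) \<partial>m) = ennreal (b - a)"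
    using to_m[of "\<lambda>_. 1"] \<open>a < b\<close> by simp
  have inv_meas[measurable]: "(\<lambda>t. inverse (g t)) \<in> borel_measurable m" by measurable
  have h: "integrable m (\<lambda>t. inverse (g t))"
    using inv_nn g(1) by (intro integrableI_nonneg) auto
  have h_int: "(\<integral>t. inverse (g t) \<partial>m) = b - a"
    using inv_nn g(1) \<open>a < b\<close> by (subst integral_eq_nn_integral) auto
  have nW1: "of_nat n * W1 m (quantile_empirical m n) =
      ennreal (\<integral>t. inverse (g t) * nearest_int_dist (real n * cdf m t) \<partial>m)" if n: "n \<ge> 1" for n
  proof -
    have "of_nat n * W1 m (quantile_empirical m n) =
        (\<integral>\<^sup>+ t. ennreal (real n) * ennreal (nearest_int_dist (real n * cdf m t) / real n) \<partial>lborel)"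
      by (simp add: W1_quantile_empirical[OF m n] nn_integral_cmult ennreal_of_nat_eq_real_of_nat)
    also have "\<dots> = (\<integral>\<^sup>+ t. ennreal (nearest_int_dist (real n * cdf m t)) * indicator {a..b} t \<partial>lborel)"
    proof (intro nn_integral_cong)
      fix t
      show "ennreal (real n) * ennreal (nearest_int_dist (real n * cdf m t) / real n) =
          ennreal (nearest_int_dist (real n * cdf m t)) * indicator {a..b} t"
        using n nearest_int_dist_cdf_outside_support[OF m ab, of t n] nearest_int_dist_bounds[of "real n * cdf m t"]
        by (cases "t \<in> {a..b}") (auto simp: ennreal_mult[symmetric])
    qed
    also have "\<dots> = (\<integral>\<^sup>+ t. ennreal (inverse (g t) * nearest_int_dist (real n * cdf m t)) \<partial>m)"
      by (rule to_m[symmetric]) (auto simp: nearest_int_dist_bounds)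
    also have "\<dots> = ennreal (\<integral>t. inverse (g t) * nearest_int_dist (real n * cdf m t) \<partial>m)"
    proof (rule nn_integral_eq_integral)
      show "integrable m (\<lambda>t. inverse (g t) * nearest_int_dist (real n * cdf m t))"
        using nearest_int_dist_bounds by (intro integrable_mult_bounded_real[OF h, where C="1 / 2"]) simp_all
    qed (auto simp: g(1) nearest_int_dist_bounds)
    finally show ?thesis .
  qed
  have "(\<lambda>n. ennreal (\<integral>t. inverse (g t) * nearest_int_dist (real n * cdf m t) \<partial>m)) \<longlonglongrightarrow> ennreal ((b - a) / 4)"
    using tendsto_integral_nearest_int_dist_cdf[OF m atomless h] by (simp add: h_int tendsto_ennrealI)
  then show ?thesis
    by (rule Lim_transform_eventually) (auto intro: eventually_sequentiallyI[of 1] simp: nW1)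
qed

theorem lemma2p1:
  fixes m :: "real measure"
  assumes "real_distribution m"
  shows
    "((\<lambda>n. W1 m (quantile_empirical m n)) \<longlonglongrightarrow> 0 \<longleftrightarrow> (\<integral>\<^sup>+ x. ennreal \<bar>x\<bar> \<partial>m) < \<infinity>) \<and>
     (\<forall>n\<ge>1. W1 m (quantile_empirical m n) \<le>
        ennreal (1 / sqrt (real n)) * (\<integral>\<^sup>+ x. ennreal (sqrt (cdf m x * (1 - cdf m x))) \<partial>lborel)) \<and>
     (\<forall>a b :: real. a < b \<longrightarrow> measure m {a..b} = 1 \<longrightarrow>
        (\<forall>n\<ge>1. W1 m (quantile_empirical m n) \<le> ennreal ((b - a) / (2 * real n)))) \<and>
     (\<forall>(a :: real) (b :: real) (f :: real \<Rightarrow> real).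
        a < b \<longrightarrow> set_borel_measurable borel {a..b} f \<longrightarrow> (\<forall>x\<in>{a..b}. f x > 0) \<longrightarrow>
        m = density lborel (\<lambda>x. ennreal (indicator {a..b} x * f x)) \<longrightarrow>
        (\<lambda>n. of_nat n * W1 m (quantile_empirical m n)) \<longlonglongrightarrow> ennreal ((b - a) / 4))"
proof (intro conjI allI impI)
  show "(\<lambda>n. W1 m (quantile_empirical m n)) \<longlonglongrightarrow> 0 \<longleftrightarrow> (\<integral>\<^sup>+ x. ennreal \<bar>x\<bar> \<partial>m) < \<infinity>"
    by (rule W1_quantile_empirical_tendsto_0_iff[OF assms])
next
  fix a b :: real and f :: "real \<Rightarrow> real"
  assume "a < b" "set_borel_measurable borel {a..b} f" "\<forall>x\<in>{a..b}. f x > 0"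
    "m = density lborel (\<lambda>x. ennreal (indicator {a..b} x * f x))"
  with assms show "(\<lambda>n. of_nat n * W1 m (quantile_empirical m n)) \<longlonglongrightarrow> ennreal ((b - a) / 4)"
    by (intro W1_quantile_empirical_density_asymp) auto
qed (blast intro: assms W1_quantile_empirical_le_sqrt W1_quantile_empirical_le_support)+

end
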